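(* Let $\alpha\in\mathbb{R}$, let $g,h\in D_\alpha$, and define $f(z_1,z_2)=g(z_1)h(z_2)$ for $(z_1,z_2)\in\mathbb{D}^2$. Then $f$ is cyclic in $\mathfrak{D}_\alpha$ if and only if $g$ and $h$ are cyclic in $D_\alpha$.
   Context: For $\alpha\in\mathbb{R}$, $D_\alpha$ is the Hilbert space of analytic functions $g(z)=\sum_{k\ge0}a_kz^k$ on the unit disk $\mathbb{D}$ with $\|g\|_{D_\alpha}^2=\sum_{k\ge0}(k+1)^\alpha|a_k|^2<\infty$, and $\mathfrak{D}_\alpha$ is the Hilbert space of holomorphic functions $f(z_1,z_2)=\sum_{k,l\ge0}a_{k,l}z_1^kz_2^l$ on the bidisk $\mathbb{D}^2$ with $\|f\|_\alpha^2=\sum_{k,l\ge0}(k+1)^\alpha(l+1)^\alpha|a_{k,l}|^2<\infty$. A function $f\in\mathfrak{D}_\alpha$ is cyclic if the closed linear span of $\{z_1^kz_2^lf: k,l\ge0\}$ is all of $\mathfrak{D}_\alpha$; equivalently, there are polynomials $p_n$ in two variables with $\|p_nf-1\|_\alpha\to0$. Likewise $g\in D_\alpha$ is cyclic if the closed linear span of $\{z^kg:k\ge0\}$ is $D_\alpha$; equivalently, there are one-variable polynomials $p_n$ with $\|p_ng-1\|_{D_\alpha}\to0$. *)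

theory Defs
  imports "HOL-Complex_Analysis.Complex_Analysis" "HOL-Library.Function_Algebras"
begin

text \<open>
  Functions on the unit disk and on the bidisk are total functions of which only the values
  on \<^term>\<open>ball 0 1 :: complex set\<close>, respectively \<open>bidisk\<close>, matter: membership in the spaces, the
  norms and cyclicity do not depend on the values elsewhere.
\<close>

definition fun_span :: "('a \<Rightarrow> complex) set \<Rightarrow> ('a \<Rightarrow> complex) set" where
  "fun_span S = module.span (\<lambda>c f x. c * f x) S"


lemma module_fun: "module (\<lambda>c f x. c * f x :: complex)"
  by unfold_locales (auto simp: fun_eq_iff algebra_simps)


definition disk_coeff :: "(complex \<Rightarrow> complex) \<Rightarrow> nat \<Rightarrow> complex" where
  "disk_coeff g k = fps_nth (fps_expansion g 0) k"

definition D_space :: "real \<Rightarrow> (complex \<Rightarrow> complex) set" where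
  "D_space \<alpha> = {g. g holomorphic_on ball 0 1 \<and>
     summable (\<lambda>k. (real k + 1) powr \<alpha> * (cmod (disk_coeff g k))\<^sup>2)}"

definition D_norm :: "real \<Rightarrow> (complex \<Rightarrow> complex) \<Rightarrow> real" where
  "D_norm \<alpha> g = sqrt (\<Sum>k. (real k + 1) powr \<alpha> * (cmod (disk_coeff g k))\<^sup>2)"

text \<open>
  The norms are meaningful only on the spaces, since the sum of a divergent series is an arbitrary
  value; hence the intersections in the closures.  Multiplication by monomials maps the spaces to
  themselves, so for the spans below these intersections remove nothing.
\<close>

definition D_closure :: "real \<Rightarrow> (complex \<Rightarrow> complex) set \<Rightarrow> (complex \<Rightarrow> complex) set" where
  "D_closure \<alpha> S = {F \<in> D_space \<alpha>. \<forall>e>0. \<exists>s \<in> S \<inter> D_space \<alpha>. D_norm \<alpha> (\<lambda>z. F z - s z) < e}"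

definition D_cyclic :: "real \<Rightarrow> (complex \<Rightarrow> complex) \<Rightarrow> bool" where
  "D_cyclic \<alpha> g \<longleftrightarrow> g \<in> D_space \<alpha> \<and>
     D_closure \<alpha> (fun_span (range (\<lambda>k. \<lambda>z. z ^ k * g z))) = D_space \<alpha>"


definition bidisk :: "(complex \<times> complex) set" where
  "bidisk = ball 0 1 \<times> ball 0 1"

text \<open>
  The holomorphic functions on the bidisk are those that are there the sum of a (necessarily
  absolutely convergent) double power series.  The coefficients are unique, which is the lemma
  \<open>has_bidisk_series_unique\<close> below, so the definite description in \<open>bidisk_coeff\<close> is
  meaningful for all these functions.
\<close>

definition has_bidisk_series ::
    "(complex \<times> complex \<Rightarrow> complex) \<Rightarrow> (nat \<Rightarrow> nat \<Rightarrow> complex) \<Rightarrow> bool" where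
  "has_bidisk_series f a \<longleftrightarrow>
     (\<forall>(z1, z2) \<in> bidisk. ((\<lambda>(k, l). a k l * z1 ^ k * z2 ^ l) has_sum f (z1, z2)) UNIV)"

definition bidisk_coeff :: "(complex \<times> complex \<Rightarrow> complex) \<Rightarrow> nat \<Rightarrow> nat \<Rightarrow> complex" where
  "bidisk_coeff f = (THE a. has_bidisk_series f a)"

definition bidisk_space :: "real \<Rightarrow> (complex \<times> complex \<Rightarrow> complex) set" where
  "bidisk_space \<alpha> = {f. (\<exists>a. has_bidisk_series f a) \<and>
     (\<lambda>(k, l). (real k + 1) powr \<alpha> * (real l + 1) powr \<alpha> * (cmod (bidisk_coeff f k l))\<^sup>2)
       summable_on UNIV}"

definition bidisk_norm :: "real \<Rightarrow> (complex \<times> complex \<Rightarrow> complex) \<Rightarrow> real" where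
  "bidisk_norm \<alpha> f = sqrt (\<Sum>\<^sub>\<infinity>(k, l).
     (real k + 1) powr \<alpha> * (real l + 1) powr \<alpha> * (cmod (bidisk_coeff f k l))\<^sup>2)"

definition bidisk_closure ::
    "real \<Rightarrow> (complex \<times> complex \<Rightarrow> complex) set \<Rightarrow> (complex \<times> complex \<Rightarrow> complex) set" where
  "bidisk_closure \<alpha> S = {F \<in> bidisk_space \<alpha>.
     \<forall>e>0. \<exists>s \<in> S \<inter> bidisk_space \<alpha>. bidisk_norm \<alpha> (\<lambda>z. F z - s z) < e}"

definition bidisk_cyclic :: "real \<Rightarrow> (complex \<times> complex \<Rightarrow> complex) \<Rightarrow> bool" where
  "bidisk_cyclic \<alpha> f \<longleftrightarrow> f \<in> bidisk_space \<alpha> \<and>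
     bidisk_closure \<alpha> (fun_span {\<lambda>(z1, z2). z1 ^ k * z2 ^ l * f (z1, z2) | k l. True})
       = bidisk_space \<alpha>"


lemma power_series_coeff_zero:
  fixes c :: "nat \<Rightarrow> complex"
  assumes c: "\<And>z. z \<in> ball 0 1 \<Longrightarrow> (\<lambda>n. c n * z ^ n) sums 0"
  shows "c n = 0"
proof (rule ccontr)
  assume n: "c n \<noteq> 0"
  have "c 0 = 0"
    using c[of 0] powser_sums_zero[of c] sums_unique2 by fastforce
  with n have "n > 0" by (cases n) auto
  show False
  proof (rule powser_0_nonzero[of 1 0 c "\<lambda>_. 0" n])
    fix s :: real
    assume "0 < s" and "\<And>z. z \<in> cball 0 s - {0::complex} \<Longrightarrow> (0::complex) \<noteq> 0"
    from this(2)[of "of_real s"] \<open>0 < s\<close> show False by auto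
  qed (use c n \<open>n > 0\<close> in auto)
qed

lemma has_bidisk_series_unique:
  assumes a: "has_bidisk_series f a" and b: "has_bidisk_series f b"
  shows "a = b"
proof -
  define d where "d = (\<lambda>k l. a k l - b k l)"
  define G where "G = (\<lambda>k z2. \<Sum>\<^sub>\<infinity>l. d k l * z2 ^ l)"
  have d: "((\<lambda>(k, l). d k l * z1 ^ k * z2 ^ l) has_sum 0) (UNIV \<times> UNIV)"
    if "z1 \<in> ball 0 1" "z2 \<in> ball 0 1" for z1 z2
  proof -
    have "((\<lambda>(k, l). a k l * z1 ^ k * z2 ^ l) has_sum f (z1, z2)) UNIV"
      "((\<lambda>(k, l). b k l * z1 ^ k * z2 ^ l) has_sum f (z1, z2)) UNIV"
      using a b that by (auto simp: has_bidisk_series_def bidisk_def)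
    from has_sum_add[OF this(1) has_sum_cmult_right[OF this(2), of "-1"]] show ?thesis
      by (simp add: d_def case_prod_unfold algebra_simps)
  qed
  have slice: "((\<lambda>l. d k l * z2 ^ l) has_sum G k z2) UNIV" if "z2 \<in> ball 0 1" for k z2
  proof -
    have "(\<lambda>(k, l). d k l * (1/2) ^ k * z2 ^ l) summable_on (UNIV \<times> UNIV)"
      using d[of "1/2" z2] that by (auto simp: summable_on_def)
    then have "(\<lambda>l. d k l * (1/2) ^ k * z2 ^ l) summable_on UNIV"
      by (rule summable_on_SigmaD1) auto
    then have "(\<lambda>l. 2 ^ k * (d k l * (1/2) ^ k * z2 ^ l)) summable_on UNIV"
      by (rule summable_on_cmult_right)
    then have "(\<lambda>l. d k l * z2 ^ l) summable_on UNIV"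
      by (simp add: power_divide)
    then show ?thesis
      unfolding G_def by (rule has_sum_infsum)
  qed
  have "(\<lambda>k. G k z2 * z1 ^ k) sums 0" if "z1 \<in> ball 0 1" "z2 \<in> ball 0 1" for z1 z2
  proof (rule has_sum_imp_sums, rule has_sum_SigmaD[OF d[OF that]])
    fix k
    show "((\<lambda>l. case (k, l) of (k, l) \<Rightarrow> d k l * z1 ^ k * z2 ^ l) has_sum G k z2 * z1 ^ k) UNIV"
      using has_sum_cmult_left[OF slice[OF that(2), of k], of "z1 ^ k"]
      by (simp add: mult_ac)
  qed
  then have "G k z2 = 0" if "z2 \<in> ball 0 1" for k z2
    using power_series_coeff_zero[of "\<lambda>k. G k z2"] that by blast
  then have "(\<lambda>l. d k l * z2 ^ l) sums 0" if "z2 \<in> ball 0 1" for k z2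
    using has_sum_imp_sums[OF slice[OF that, of k]] that by simp
  then have "d k l = 0" for k l
    by (rule power_series_coeff_zero)
  then show ?thesis by (simp add: d_def fun_eq_iff)
qed

lemma bidisk_coeff_eq: "has_bidisk_series f a \<Longrightarrow> bidisk_coeff f = a"
  unfolding bidisk_coeff_def by (blast intro: has_bidisk_series_unique)

end

(* Write (g \<otimes> h)(z1, z2) = g z1 * h z2, so that the norm of g \<otimes> h is the product of the norms.
   If s approximates F \<otimes> 1 and is a combination of monomial multiples of g \<otimes> h, then s(z, 0) is a
   combination of the z ^ k * g z and approximates F, because restriction to z2 = 0 keeps only
   coefficients of weight (0 + 1) powr \<alpha> = 1 in the second index and so is a contraction.  Conversely,
   if u and v in the spans of g and h approximate z ^ k and z ^ l, then u \<otimes> v approximates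
   z1 ^ k * z2 ^ l, and the polynomials are dense. *)
theory Submission
  imports Defs
begin

section \<open>Weighted square-summable families\<close>

text \<open>The index type is left open: \<open>nat\<close> serves the disk and
  \<open>nat \<times> nat\<close> the bidisk, so the norm estimates are proved once for both
  spaces.\<close>

definition l2 :: "('i \<Rightarrow> real) \<Rightarrow> ('i \<Rightarrow> complex) set" where
  "l2 w = {a. (\<lambda>i. w i * (cmod (a i))\<^sup>2) summable_on UNIV}"

text \<open>Outside \<open>l2 w\<close>, for nonnegative \<open>w\<close>, the value is 0, since
  \<open>infsum\<close> is 0 on families that are not summable. Membership therefore has to
  accompany every estimate.\<close>

definition l2_norm :: "('i \<Rightarrow> real) \<Rightarrow> ('i \<Rightarrow> complex) \<Rightarrow> real" where
  "l2_norm w a = sqrt (\<Sum>\<^sub>\<infinity>i. w i * (cmod (a i))\<^sup>2)"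

lemma l2_norm_nonneg: "(\<And>i. w i \<ge> 0) \<Longrightarrow> l2_norm w a \<ge> 0"
  by (simp add: l2_norm_def infsum_nonneg)

lemma l2_norm_squared:
  "(\<And>i. w i \<ge> 0) \<Longrightarrow> (l2_norm w a)\<^sup>2 = (\<Sum>\<^sub>\<infinity>i. w i * (cmod (a i))\<^sup>2)"
  by (simp add: l2_norm_def infsum_nonneg)

text \<open>The square root of the weight is moved into the entries, which makes Minkowski's
  inequality for \<open>L2_set\<close> available.\<close>

lemma L2_set_weighted:
  assumes "\<And>i. w i \<ge> 0"
  shows "(L2_set (\<lambda>i. sqrt (w i) * cmod (a i)) F)\<^sup>2 = (\<Sum>i\<in>F. w i * (cmod (a i))\<^sup>2)"
  using assms by (simp add: L2_set_def sum_nonneg power_mult_distrib)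

lemma L2_set_le_l2_norm:
  assumes w: "\<And>i. w i \<ge> 0" and "a \<in> l2 w" "finite F"
  shows "L2_set (\<lambda>i. sqrt (w i) * cmod (a i)) F \<le> l2_norm w a"
proof (rule power2_le_imp_le)
  show "(L2_set (\<lambda>i. sqrt (w i) * cmod (a i)) F)\<^sup>2 \<le> (l2_norm w a)\<^sup>2"
    unfolding L2_set_weighted[OF w] l2_norm_squared[OF w]
    using assms by (intro finite_sum_le_infsum) (auto simp: l2_def)
qed (rule l2_norm_nonneg[OF w])

text \<open>Minkowski's inequality on finite index sets gives a bound that does not depend on the
  set, and this bound yields both summability and the norm estimate. With \<open>c = -1\<close> it
  covers differences.\<close>

lemma l2_lincomb:
  assumes w: "\<And>i. w i \<ge> 0" and a: "a \<in> l2 w" and b: "b \<in> l2 w"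
  shows "(\<lambda>i. c * a i + b i) \<in> l2 w" (is "?d \<in> _")
    and "l2_norm w (\<lambda>i. c * a i + b i) \<le> cmod c * l2_norm w a + l2_norm w b" (is "_ \<le> ?B")
proof -
  have B: "?B \<ge> 0"
    by (intro add_nonneg_nonneg mult_nonneg_nonneg l2_norm_nonneg[OF w]) auto
  have le: "(\<Sum>i\<in>F. w i * (cmod (?d i))\<^sup>2) \<le> ?B\<^sup>2" if "finite F" for F
  proof -
    have "L2_set (\<lambda>i. sqrt (w i) * cmod (?d i)) F
        \<le> L2_set (\<lambda>i. cmod c * (sqrt (w i) * cmod (a i)) + sqrt (w i) * cmod (b i)) F"
    proof (rule L2_set_mono)
      fix i
      have "sqrt (w i) * cmod (?d i) \<le> sqrt (w i) * (cmod c * cmod (a i) + cmod (b i))"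
        using w by (intro mult_left_mono) (auto simp: norm_mult intro: order_trans[OF norm_triangle_ineq])
      then show "sqrt (w i) * cmod (?d i) \<le> cmod c * (sqrt (w i) * cmod (a i)) + sqrt (w i) * cmod (b i)"
        by (simp add: algebra_simps)
    qed (use w in auto)
    also have "\<dots> \<le> L2_set (\<lambda>i. cmod c * (sqrt (w i) * cmod (a i))) F
        + L2_set (\<lambda>i. sqrt (w i) * cmod (b i)) F"
      by (rule L2_set_triangle_ineq)
    also have "\<dots> = cmod c * L2_set (\<lambda>i. sqrt (w i) * cmod (a i)) F
        + L2_set (\<lambda>i. sqrt (w i) * cmod (b i)) F"
      by (simp add: L2_set_right_distrib)
    also have "\<dots> \<le> ?B"
      using L2_set_le_l2_norm[OF w a that] L2_set_le_l2_norm[OF w b that]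
      by (intro add_mono mult_left_mono) auto
    finally have "(L2_set (\<lambda>i. sqrt (w i) * cmod (?d i)) F)\<^sup>2 \<le> ?B\<^sup>2"
      by (intro power_mono) auto
    then show ?thesis by (simp only: L2_set_weighted[OF w])
  qed
  have "(\<lambda>i. w i * (cmod (?d i))\<^sup>2) summable_on UNIV"
    using w le by (intro nonneg_bdd_above_summable_on bdd_aboveI[of _ "?B\<^sup>2"]) auto
  then show "?d \<in> l2 w" by (simp add: l2_def)
  with le have "(l2_norm w ?d)\<^sup>2 \<le> ?B\<^sup>2"
    unfolding l2_norm_squared[OF w] by (intro infsum_le_finite_sums) (auto simp: l2_def)
  then show "l2_norm w ?d \<le> ?B"
    using B by (rule power2_le_imp_le)
qed

text \<open>The reindexed sum is the sum over \<open>range j\<close>, a part of a sum of nonnegative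
  terms. It is applied to the slice \<open>k \<mapsto> (k, 0)\<close> and to the exchange of the two
  indices.\<close>

lemma l2_reindex:
  assumes w: "\<And>i. w i \<ge> 0" and "inj j" and a: "a \<in> l2 w"
  shows "(\<lambda>i. a (j i)) \<in> l2 (\<lambda>i. w (j i))"
    and "l2_norm (\<lambda>i. w (j i)) (\<lambda>i. a (j i)) \<le> l2_norm w a"
proof -
  have sub: "(\<lambda>i. w i * (cmod (a i))\<^sup>2) summable_on range j"
    using a by (auto simp: l2_def intro: summable_on_subset)
  then show "(\<lambda>i. a (j i)) \<in> l2 (\<lambda>i. w (j i))"
    using \<open>inj j\<close> by (simp add: l2_def summable_on_reindex o_def)
  have "(\<Sum>\<^sub>\<infinity>i. w (j i) * (cmod (a (j i)))\<^sup>2) = (\<Sum>\<^sub>\<infinity>i\<in>range j. w i * (cmod (a i))\<^sup>2)"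
    using \<open>inj j\<close> by (simp add: infsum_reindex o_def)
  also have "\<dots> \<le> (\<Sum>\<^sub>\<infinity>i. w i * (cmod (a i))\<^sup>2)"
    using a sub w by (intro infsum_mono2) (auto simp: l2_def)
  finally show "l2_norm (\<lambda>i. w (j i)) (\<lambda>i. a (j i)) \<le> l2_norm w a"
    by (simp add: l2_norm_def)
qed

lemma l2_truncation:
  assumes w: "\<And>i. w i \<ge> 0" and a: "a \<in> l2 w" and "e > 0"
  obtains J where "finite J" "l2_norm w (\<lambda>i. a i - (if i \<in> J then a i else 0)) < e"
proof -
  let ?s = "\<lambda>i. w i * (cmod (a i))\<^sup>2"
  have s: "?s summable_on UNIV" using a by (simp add: l2_def)
  \<comment> \<open>The squared norm of the remainder is the tail of the series, hence the square;
    the half turns the non-strict bound into a strict one.\<close>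
  obtain J where J: "finite J" "dist (sum ?s J) (infsum ?s UNIV) \<le> (e/2)\<^sup>2"
    using infsum_finite_approximation[OF s, of "(e/2)\<^sup>2"] \<open>e > 0\<close> by auto
  have "infsum ?s (UNIV - J) = infsum ?s UNIV - sum ?s J"
    using infsum_Diff[OF s summable_on_finite[OF J(1)]] J(1) by (simp add: infsum_finite)
  moreover have "(\<Sum>\<^sub>\<infinity>i. w i * (cmod (a i - (if i \<in> J then a i else 0)))\<^sup>2) = infsum ?s (UNIV - J)"
    by (rule infsum_cong_neutral) auto
  ultimately have "(l2_norm w (\<lambda>i. a i - (if i \<in> J then a i else 0)))\<^sup>2 \<le> (e/2)\<^sup>2"
    using J(2) by (simp add: l2_norm_squared[OF w] dist_real_def)
  then have "l2_norm w (\<lambda>i. a i - (if i \<in> J then a i else 0)) \<le> e/2"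
    by (rule power2_le_imp_le) (use \<open>e > 0\<close> in simp)
  with \<open>e > 0\<close> J(1) show ?thesis by (intro that) auto
qed

text \<open>Absolute summability of both factors makes the family of products absolutely summable
  over pairs, and then its sum may be computed iteratively. The value type is general because the
  lemma serves the real series of the norms and the complex power series.\<close>

lemma has_sum_product_pairs:
  fixes x :: "'i \<Rightarrow> 'c :: {real_normed_field, banach}" and y :: "'j \<Rightarrow> 'c"
  assumes x: "(x has_sum s) UNIV" "(\<lambda>i. norm (x i)) summable_on UNIV"
    and y: "(y has_sum t) UNIV" "(\<lambda>j. norm (y j)) summable_on UNIV"
  shows "((\<lambda>(i, j). x i * y j) has_sum s * t) UNIV"
proof -
  have "(\<lambda>p. norm (case p of (i, j) \<Rightarrow> x i * y j)) summable_on UNIV \<times> UNIV"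
    unfolding Infinite_Sum.abs_summable_on_Sigma_iff using x(2) y(2)
    by (auto simp: norm_mult infsum_cmult_right' abs_mult infsum_nonneg
        intro!: summable_on_cmult_right summable_on_cmult_left)
  then have "(\<lambda>(i, j). x i * y j) summable_on UNIV \<times> UNIV"
    by (rule abs_summable_summable)
  then have "((\<lambda>(i, j). x i * y j) has_sum s * t) (UNIV \<times> UNIV)"
    by (rule has_sum_SigmaI[rotated 2])
      (auto intro!: has_sum_cmult_right has_sum_cmult_left x y)
  then show ?thesis by simp
qed

text \<open>The weight of a pair is a product, so the squared norm is the product of two nonnegative
  series.\<close>

lemma l2_tensor:
  assumes v: "\<And>i. v i \<ge> 0" and w: "\<And>j. w j \<ge> 0" and a: "a \<in> l2 v" and b: "b \<in> l2 w"
  shows "(\<lambda>(i, j). a i * b j) \<in> l2 (\<lambda>(i, j). v i * w j)"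
    and "l2_norm (\<lambda>(i, j). v i * w j) (\<lambda>(i, j). a i * b j) = l2_norm v a * l2_norm w b"
proof -
  let ?x = "\<lambda>i. v i * (cmod (a i))\<^sup>2" and ?y = "\<lambda>j. w j * (cmod (b j))\<^sup>2"
  have x: "?x summable_on UNIV" and y: "?y summable_on UNIV" using a b by (auto simp: l2_def)
  have "((\<lambda>(i, j). ?x i * ?y j) has_sum infsum ?x UNIV * infsum ?y UNIV) UNIV"
    using x y v w by (intro has_sum_product_pairs) auto
  then have *: "((\<lambda>p. (case p of (i, j) \<Rightarrow> v i * w j) * (cmod (case p of (i, j) \<Rightarrow> a i * b j))\<^sup>2)
      has_sum infsum ?x UNIV * infsum ?y UNIV) UNIV"
    by (simp add: case_prod_unfold norm_mult power_mult_distrib mult_ac)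
  show "(\<lambda>(i, j). a i * b j) \<in> l2 (\<lambda>(i, j). v i * w j)"
    unfolding l2_def mem_Collect_eq using * by (rule has_sum_imp_summable)
  show "l2_norm (\<lambda>(i, j). v i * w j) (\<lambda>(i, j). a i * b j) = l2_norm v a * l2_norm w b"
    unfolding l2_norm_def infsumI[OF *] by (rule real_sqrt_mult)
qed


section \<open>The spaces in terms of coefficients\<close>

definition disk_weight :: "real \<Rightarrow> nat \<Rightarrow> real" where
  "disk_weight \<alpha> k = (real k + 1) powr \<alpha>"

definition bidisk_weight :: "real \<Rightarrow> nat \<times> nat \<Rightarrow> real" where
  "bidisk_weight \<alpha> = (\<lambda>(k, l). disk_weight \<alpha> k * disk_weight \<alpha> l)"

lemma disk_weight_nonneg: "disk_weight \<alpha> k \<ge> 0"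
  by (simp add: disk_weight_def)

lemma bidisk_weight_nonneg: "bidisk_weight \<alpha> p \<ge> 0"
  by (simp add: bidisk_weight_def disk_weight_def case_prod_unfold)

text \<open>Summation is unordered as in \<open>has_bidisk_series\<close>, so that products and
  slices of series can be formed without reordering.\<close>

definition has_disk_series :: "(complex \<Rightarrow> complex) \<Rightarrow> (nat \<Rightarrow> complex) \<Rightarrow> bool" where
  "has_disk_series g a \<longleftrightarrow> (\<forall>z \<in> ball 0 1. ((\<lambda>k. a k * z ^ k) has_sum g z) UNIV)"

lemma power_series_abs_summable:
  fixes a :: "nat \<Rightarrow> complex"
  assumes "\<And>z. z \<in> ball 0 1 \<Longrightarrow> summable (\<lambda>k. a k * z ^ k)" and "z \<in> ball 0 1"
  shows "(\<lambda>k. norm (a k * z ^ k)) summable_on UNIV"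
proof -
  \<comment> \<open>The midpoint of \<open>cmod z\<close> and 1: convergence at the point
    \<open>r\<close> of the disk forces absolute convergence at every point of smaller
    modulus.\<close>
  define r where "r = (1 + cmod z) / 2"
  have r: "cmod z < r" "r < 1" "0 \<le> r" using assms(2) by (auto simp: r_def field_simps add_nonneg_nonneg)
  have "summable (\<lambda>k. norm (a k * z ^ k))"
    by (rule powser_insidea[of a "of_real r"]) (use r assms(1) in auto)
  then show ?thesis by (simp add: summable_on_UNIV_nonneg_real_iff)
qed

text \<open>A power series that converges at all points of the open disk converges absolutely there,
  so ordered and unordered summation agree.\<close>

lemma has_disk_series_iff_sums:
  "has_disk_series g a \<longleftrightarrow> (\<forall>z \<in> ball 0 1. (\<lambda>k. a k * z ^ k) sums g z)"
proof
  assume sums: "\<forall>z \<in> ball 0 1. (\<lambda>k. a k * z ^ k) sums g z"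
  show "has_disk_series g a"
    unfolding has_disk_series_def
  proof
    fix z :: complex assume z: "z \<in> ball 0 1"
    have "(\<lambda>k. norm (a k * z ^ k)) summable_on UNIV"
      using sums by (intro power_series_abs_summable z) (auto simp: sums_iff)
    then show "((\<lambda>k. a k * z ^ k) has_sum g z) UNIV"
      using sums z by (intro norm_summable_imp_has_sum) (auto simp: summable_on_UNIV_nonneg_real_iff)
  qed
qed (auto simp: has_disk_series_def intro: has_sum_imp_sums)

lemma has_disk_series_abs_summable:
  "has_disk_series g a \<Longrightarrow> z \<in> ball 0 1 \<Longrightarrow> (\<lambda>k. norm (a k * z ^ k)) summable_on UNIV"
  by (rule power_series_abs_summable) (auto simp: has_disk_series_iff_sums sums_iff)

lemma has_disk_series_disk_coeff:
  assumes "g holomorphic_on ball 0 1"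
  shows "has_disk_series g (disk_coeff g)"
  using holomorphic_power_series[OF assms]
  by (simp add: has_disk_series_iff_sums disk_coeff_def fps_expansion_def)

lemma has_disk_series_unique:
  assumes "has_disk_series g a" "has_disk_series g b"
  shows "a = b"
proof
  fix k
  have "a k - b k = 0"
  proof (rule power_series_coeff_zero)
    fix z :: complex assume "z \<in> ball 0 1"
    then have "(\<lambda>k. a k * z ^ k - b k * z ^ k) sums (g z - g z)"
      using assms by (intro sums_diff) (auto simp: has_disk_series_iff_sums)
    then show "(\<lambda>k. (a k - b k) * z ^ k) sums 0"
      by (simp add: left_diff_distrib)
  qed
  then show "a k = b k" by simp
qed

lemma has_disk_series_holomorphic:
  assumes "has_disk_series g a"
  shows "g holomorphic_on ball 0 1" "disk_coeff g = a"
proof -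
  show "g holomorphic_on ball 0 1"
    using assms by (intro power_series_holomorphic[where a = a]) (auto simp: has_disk_series_iff_sums)
  then show "disk_coeff g = a"
    by (rule has_disk_series_unique[OF has_disk_series_disk_coeff assms])
qed

lemma D_space_iff: "has_disk_series g a \<Longrightarrow> g \<in> D_space \<alpha> \<longleftrightarrow> a \<in> l2 (disk_weight \<alpha>)"
  by (simp add: D_space_def l2_def disk_weight_def has_disk_series_holomorphic
      summable_on_UNIV_nonneg_real_iff)

text \<open>\<open>D_norm\<close> is built on \<open>suminf\<close> and \<open>l2_norm\<close> on
  \<open>infsum\<close>, whose values at divergent series need not agree; the comparison is
  therefore made inside the space.\<close>

lemma D_norm_eq:
  assumes "has_disk_series g a" "g \<in> D_space \<alpha>"
  shows "D_norm \<alpha> g = l2_norm (disk_weight \<alpha>) a"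
proof -
  have "a \<in> l2 (disk_weight \<alpha>)" using D_space_iff[OF assms(1)] assms(2) by simp
  then have "((\<lambda>k. disk_weight \<alpha> k * (cmod (a k))\<^sup>2) has_sum (l2_norm (disk_weight \<alpha>) a)\<^sup>2) UNIV"
    unfolding l2_norm_squared[OF disk_weight_nonneg] by (auto simp: l2_def)
  then have "(\<Sum>k. disk_weight \<alpha> k * (cmod (a k))\<^sup>2) = (l2_norm (disk_weight \<alpha>) a)\<^sup>2"
    using has_sum_imp_sums sums_unique by metis
  then show ?thesis
    by (simp add: D_norm_def has_disk_series_holomorphic(2)[OF assms(1)] disk_weight_def[symmetric]
        l2_norm_nonneg[OF disk_weight_nonneg])
qed

lemma D_spaceE:
  assumes "g \<in> D_space \<alpha>"
  obtains a where "has_disk_series g a" "a \<in> l2 (disk_weight \<alpha>)" "D_norm \<alpha> g = l2_norm (disk_weight \<alpha>) a"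
  using has_disk_series_disk_coeff[of g] assms D_space_iff D_norm_eq
  by (metis (no_types, lifting) D_space_def mem_Collect_eq)

lemma D_norm_nonneg: "g \<in> D_space \<alpha> \<Longrightarrow> D_norm \<alpha> g \<ge> 0"
  by (erule D_spaceE) (simp add: l2_norm_nonneg disk_weight_nonneg)

lemma has_disk_series_lincomb:
  assumes "has_disk_series f a" "has_disk_series g b"
  shows "has_disk_series (\<lambda>z. c * f z + g z) (\<lambda>k. c * a k + b k)"
  unfolding has_disk_series_def
proof
  fix z :: complex assume "z \<in> ball 0 1"
  then have "((\<lambda>k. c * (a k * z ^ k) + b k * z ^ k) has_sum (c * f z + g z)) UNIV"
    using assms by (intro has_sum_add has_sum_cmult_right) (auto simp: has_disk_series_def)
  then show "((\<lambda>k. (c * a k + b k) * z ^ k) has_sum (c * f z + g z)) UNIV"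
    by (simp add: algebra_simps)
qed

lemma D_space_diff:
  assumes "f \<in> D_space \<alpha>" "g \<in> D_space \<alpha>"
  shows "(\<lambda>z. f z - g z) \<in> D_space \<alpha>"
proof -
  from assms obtain a b where a: "has_disk_series f a" "a \<in> l2 (disk_weight \<alpha>)"
    and b: "has_disk_series g b" "b \<in> l2 (disk_weight \<alpha>)" by (auto elim!: D_spaceE)
  then have "(\<lambda>z. (-1) * g z + f z) \<in> D_space \<alpha>"
    using D_space_iff[OF has_disk_series_lincomb[OF b(1) a(1)]]
      l2_lincomb(1)[OF disk_weight_nonneg b(2) a(2)] by blast
  then show ?thesis by simp
qed

lemma has_disk_series_cong:
  "(\<And>z. z \<in> ball 0 1 \<Longrightarrow> f z = g z) \<Longrightarrow> has_disk_series f a \<longleftrightarrow> has_disk_series g a"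
  by (simp add: has_disk_series_def)

text \<open>Approximants found later are known only on the disk; this transfers membership and norm
  to them.\<close>

lemma D_space_cong:
  assumes "f \<in> D_space \<alpha>" "\<And>z. z \<in> ball 0 1 \<Longrightarrow> f z = g z"
  shows "g \<in> D_space \<alpha>" "D_norm \<alpha> f = D_norm \<alpha> g"
proof -
  obtain a where a: "has_disk_series f a" "a \<in> l2 (disk_weight \<alpha>)" "D_norm \<alpha> f = l2_norm (disk_weight \<alpha>) a"
    using assms(1) by (rule D_spaceE)
  moreover have "has_disk_series g a" using a(1) assms(2) has_disk_series_cong by blast
  ultimately show "g \<in> D_space \<alpha>" "D_norm \<alpha> f = D_norm \<alpha> g"
    using D_space_iff D_norm_eq by metis+
qed

lemma has_disk_series_monomial: "has_disk_series (\<lambda>z. z ^ m) (\<lambda>k. if k = m then 1 else 0)"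
  unfolding has_disk_series_def
proof
  fix z :: complex
  show "((\<lambda>k. (if k = m then 1 else 0) * z ^ k) has_sum z ^ m) UNIV"
    by (subst has_sum_cong_neutral[where T = "{m}" and g = "\<lambda>k. z ^ k"])
      (auto intro: has_sum_finiteI)
qed

lemma monomial_in_D_space: "(\<lambda>z. z ^ m) \<in> D_space \<alpha>"
proof -
  have "(\<lambda>k. disk_weight \<alpha> k * (cmod (if k = m then 1 else 0))\<^sup>2) summable_on UNIV"
    by (subst summable_on_cong_neutral[where T = "{m}" and g = "\<lambda>k. disk_weight \<alpha> k"]) auto
  then show ?thesis
    by (simp add: D_space_iff[OF has_disk_series_monomial] l2_def)
qed

section \<open>Coefficients and norms on the bidisk\<close>

lemma bidisk_space_iff:
  "has_bidisk_series f a \<Longrightarrow> f \<in> bidisk_space \<alpha> \<longleftrightarrow> (\<lambda>(k, l). a k l) \<in> l2 (bidisk_weight \<alpha>)"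
  by (auto simp: bidisk_space_def l2_def bidisk_weight_def disk_weight_def case_prod_unfold bidisk_coeff_eq)

lemma bidisk_norm_eq:
  "has_bidisk_series f a \<Longrightarrow> bidisk_norm \<alpha> f = l2_norm (bidisk_weight \<alpha>) (\<lambda>(k, l). a k l)"
  by (simp add: bidisk_norm_def l2_norm_def bidisk_weight_def disk_weight_def case_prod_unfold bidisk_coeff_eq)

lemma bidisk_spaceE:
  assumes "f \<in> bidisk_space \<alpha>"
  obtains a where "has_bidisk_series f a" "(\<lambda>(k, l). a k l) \<in> l2 (bidisk_weight \<alpha>)"
    "bidisk_norm \<alpha> f = l2_norm (bidisk_weight \<alpha>) (\<lambda>(k, l). a k l)"
proof -
  obtain a where a: "has_bidisk_series f a"
    using assms by (auto simp: bidisk_space_def)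
  show ?thesis
    using assms by (intro that[OF a]) (simp_all only: bidisk_space_iff[OF a] bidisk_norm_eq[OF a])
qed

lemma has_bidisk_series_lincomb:
  assumes "has_bidisk_series f a" "has_bidisk_series g b"
  shows "has_bidisk_series (\<lambda>z. c * f z + g z) (\<lambda>k l. c * a k l + b k l)"
  unfolding has_bidisk_series_def
proof clarify
  fix z1 z2 assume "(z1, z2) \<in> bidisk"
  then have "((\<lambda>p. c * (case p of (k, l) \<Rightarrow> a k l * z1 ^ k * z2 ^ l)
      + (case p of (k, l) \<Rightarrow> b k l * z1 ^ k * z2 ^ l)) has_sum (c * f (z1, z2) + g (z1, z2))) UNIV"
    using assms by (intro has_sum_add has_sum_cmult_right) (auto simp: has_bidisk_series_def)
  then show "((\<lambda>(k, l). (c * a k l + b k l) * z1 ^ k * z2 ^ l)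
      has_sum (c * f (z1, z2) + g (z1, z2))) UNIV"
    by (simp add: algebra_simps case_prod_unfold)
qed

lemma bidisk_space_lincomb:
  assumes "f \<in> bidisk_space \<alpha>" "g \<in> bidisk_space \<alpha>"
  shows "(\<lambda>z. c * f z + g z) \<in> bidisk_space \<alpha>"
    and "bidisk_norm \<alpha> (\<lambda>z. c * f z + g z) \<le> cmod c * bidisk_norm \<alpha> f + bidisk_norm \<alpha> g"
proof -
  from assms obtain a b
    where a: "has_bidisk_series f a" "(\<lambda>(k, l). a k l) \<in> l2 (bidisk_weight \<alpha>)"
    and b: "has_bidisk_series g b" "(\<lambda>(k, l). b k l) \<in> l2 (bidisk_weight \<alpha>)"
    by (auto elim!: bidisk_spaceE)
  note s = has_bidisk_series_lincomb[OF a(1) b(1), of c]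
  have eq: "(\<lambda>p. c * (case p of (k, l) \<Rightarrow> a k l) + (case p of (k, l) \<Rightarrow> b k l))
      = (\<lambda>(k, l). c * a k l + b k l)" by auto
  show "(\<lambda>z. c * f z + g z) \<in> bidisk_space \<alpha>"
    unfolding bidisk_space_iff[OF s] using l2_lincomb(1)[OF bidisk_weight_nonneg a(2) b(2), of c]
    by (simp only: eq)
  show "bidisk_norm \<alpha> (\<lambda>z. c * f z + g z) \<le> cmod c * bidisk_norm \<alpha> f + bidisk_norm \<alpha> g"
    unfolding bidisk_norm_eq[OF s] bidisk_norm_eq[OF a(1)] bidisk_norm_eq[OF b(1)]
    using l2_lincomb(2)[OF bidisk_weight_nonneg a(2) b(2), of c] by (simp only: eq)
qed

lemma bidisk_space_diff:
  assumes "f \<in> bidisk_space \<alpha>" "g \<in> bidisk_space \<alpha>"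
  shows "(\<lambda>z. f z - g z) \<in> bidisk_space \<alpha>"
  using bidisk_space_lincomb(1)[OF assms(2,1), of "-1"] by simp

lemma bidisk_space_cong:
  assumes "f \<in> bidisk_space \<alpha>" "\<And>z. z \<in> bidisk \<Longrightarrow> f z = g z"
  shows "g \<in> bidisk_space \<alpha>" "bidisk_norm \<alpha> f = bidisk_norm \<alpha> g"
proof -
  obtain a where a: "has_bidisk_series f a" using assms(1) by (rule bidisk_spaceE)
  then have "has_bidisk_series g a"
    using assms(2) by (fastforce simp: has_bidisk_series_def)
  with a assms(1) show "g \<in> bidisk_space \<alpha>" "bidisk_norm \<alpha> f = bidisk_norm \<alpha> g"
    by (auto simp: bidisk_space_iff bidisk_norm_eq)
qed

section \<open>Tensor products, slices and the exchange of variables\<close>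

lemma has_bidisk_series_tensor:
  assumes "has_disk_series g a" "has_disk_series h b"
  shows "has_bidisk_series (\<lambda>(z1, z2). g z1 * h z2) (\<lambda>k l. a k * b l)"
  unfolding has_bidisk_series_def
proof clarify
  fix z1 z2 assume "(z1, z2) \<in> bidisk"
  then have z: "z1 \<in> ball 0 1" "z2 \<in> ball 0 1" by (auto simp: bidisk_def)
  have "((\<lambda>k. a k * z1 ^ k) has_sum g z1) UNIV" "((\<lambda>l. b l * z2 ^ l) has_sum h z2) UNIV"
    using assms z unfolding has_disk_series_def by blast+
  then have "((\<lambda>(k, l). (a k * z1 ^ k) * (b l * z2 ^ l)) has_sum g z1 * h z2) UNIV"
    using has_disk_series_abs_summable[OF assms(1) z(1)] has_disk_series_abs_summable[OF assms(2) z(2)]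
    by (intro has_sum_product_pairs)
  then show "((\<lambda>(k, l). a k * b l * z1 ^ k * z2 ^ l) has_sum (g z1 * h z2)) UNIV"
    by (simp add: mult_ac)
qed

lemma bidisk_space_tensor:
  assumes "g \<in> D_space \<alpha>" "h \<in> D_space \<alpha>"
  shows "(\<lambda>(z1, z2). g z1 * h z2) \<in> bidisk_space \<alpha>"
    and "bidisk_norm \<alpha> (\<lambda>(z1, z2). g z1 * h z2) = D_norm \<alpha> g * D_norm \<alpha> h"
proof -
  obtain a where a: "has_disk_series g a" "a \<in> l2 (disk_weight \<alpha>)" "D_norm \<alpha> g = l2_norm (disk_weight \<alpha>) a"
    using assms(1) by (rule D_spaceE)
  obtain b where b: "has_disk_series h b" "b \<in> l2 (disk_weight \<alpha>)" "D_norm \<alpha> h = l2_norm (disk_weight \<alpha>) b"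
    using assms(2) by (rule D_spaceE)
  note s = has_bidisk_series_tensor[OF a(1) b(1)]
  note t = l2_tensor[OF disk_weight_nonneg disk_weight_nonneg a(2) b(2)]
  show "(\<lambda>(z1, z2). g z1 * h z2) \<in> bidisk_space \<alpha>"
    using t(1) by (simp add: bidisk_space_iff[OF s] bidisk_weight_def)
  show "bidisk_norm \<alpha> (\<lambda>(z1, z2). g z1 * h z2) = D_norm \<alpha> g * D_norm \<alpha> h"
    using t(2) by (simp add: bidisk_norm_eq[OF s] bidisk_weight_def a(3) b(3))
qed

lemma bidisk_space_slice:
  assumes "f \<in> bidisk_space \<alpha>"
  shows "(\<lambda>z. f (z, 0)) \<in> D_space \<alpha>" "D_norm \<alpha> (\<lambda>z. f (z, 0)) \<le> bidisk_norm \<alpha> f"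
proof -
  obtain a where a: "has_bidisk_series f a" "(\<lambda>(k, l). a k l) \<in> l2 (bidisk_weight \<alpha>)"
    "bidisk_norm \<alpha> f = l2_norm (bidisk_weight \<alpha>) (\<lambda>(k, l). a k l)"
    using assms by (rule bidisk_spaceE)
  have s: "has_disk_series (\<lambda>z. f (z, 0)) (\<lambda>k. a k 0)"
    unfolding has_disk_series_def
  proof
    fix z :: complex assume "z \<in> ball 0 1"
    then have "((\<lambda>(k, l). a k l * z ^ k * 0 ^ l) has_sum f (z, 0)) UNIV"
      using a(1) by (auto simp: has_bidisk_series_def bidisk_def)
    \<comment> \<open>Here \<open>0 ^ 0 = 1\<close> keeps the terms with \<open>l = 0\<close>, and
      all other terms vanish.\<close>
    then have "((\<lambda>(k, l). a k l * z ^ k * 0 ^ l) has_sum f (z, 0)) (range (\<lambda>k. (k, 0)))"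
      by (rule has_sum_cong_neutral[THEN iffD1, rotated -1]) (auto simp: image_iff)
    then show "((\<lambda>k. a k 0 * z ^ k) has_sum f (z, 0)) UNIV"
      by (subst (asm) has_sum_reindex) (auto simp: inj_on_def o_def)
  qed
  have w: "bidisk_weight \<alpha> (k, 0) = disk_weight \<alpha> k" for k
    by (simp add: bidisk_weight_def disk_weight_def)
  have inj: "inj (\<lambda>k::nat. (k, 0::nat))" by (simp add: inj_on_def)
  note r = l2_reindex[OF bidisk_weight_nonneg inj a(2), unfolded w prod.case]
  from r(1) show D: "(\<lambda>z. f (z, 0)) \<in> D_space \<alpha>" by (simp add: D_space_iff[OF s])
  show "D_norm \<alpha> (\<lambda>z. f (z, 0)) \<le> bidisk_norm \<alpha> f"
    using r(2) by (simp add: D_norm_eq[OF s D] a(3))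
qed

lemma bidisk_space_swap:
  assumes "f \<in> bidisk_space \<alpha>"
  shows "f \<circ> prod.swap \<in> bidisk_space \<alpha>" "bidisk_norm \<alpha> (f \<circ> prod.swap) = bidisk_norm \<alpha> f"
proof -
  obtain a where a: "has_bidisk_series f a" "(\<lambda>(k, l). a k l) \<in> l2 (bidisk_weight \<alpha>)"
    "bidisk_norm \<alpha> f = l2_norm (bidisk_weight \<alpha>) (\<lambda>(k, l). a k l)"
    using assms by (rule bidisk_spaceE)
  have s: "has_bidisk_series (f \<circ> prod.swap) (\<lambda>k l. a l k)"
    unfolding has_bidisk_series_def
  proof clarify
    fix z1 z2 assume "(z1, z2) \<in> bidisk"
    then have "((\<lambda>(k, l). a k l * z2 ^ k * z1 ^ l) has_sum f (z2, z1)) (UNIV \<times> UNIV)"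
      using a(1) by (auto simp: has_bidisk_series_def bidisk_def)
    from has_sum_swap[THEN iffD1, OF this]
    show "((\<lambda>(k, l). a l k * z1 ^ k * z2 ^ l) has_sum (f \<circ> prod.swap) (z1, z2)) UNIV"
      by (simp add: mult_ac)
  qed
  have w: "bidisk_weight \<alpha> (prod.swap p) = bidisk_weight \<alpha> p" for p
    by (simp add: bidisk_weight_def case_prod_unfold)
  have eq: "(\<lambda>p. case prod.swap p of (k, l) \<Rightarrow> a k l) = (\<lambda>(k, l). a l k)" by auto
  note r = l2_reindex[where w = "bidisk_weight \<alpha>", OF bidisk_weight_nonneg inj_swap, unfolded w]
  show "f \<circ> prod.swap \<in> bidisk_space \<alpha>"
    using r(1)[OF a(2)] by (simp add: bidisk_space_iff[OF s] eq)
  have eq': "(\<lambda>p. case prod.swap p of (k, l) \<Rightarrow> a l k) = (\<lambda>(k, l). a k l)" by auto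
  \<comment> \<open>Reindexing gives one inequality; a second application gives the reverse one,
    because the exchange is an involution.\<close>
  show "bidisk_norm \<alpha> (f \<circ> prod.swap) = bidisk_norm \<alpha> f"
    using r(2)[OF a(2)] r(2)[OF r(1)[OF a(2)]] by (simp add: bidisk_norm_eq[OF s] a(3) eq eq')
qed


section \<open>Spans and closures\<close>

lemma fun_span_base: "f \<in> S \<Longrightarrow> f \<in> fun_span S"
  by (simp add: fun_span_def module.span_base[OF module_fun])

lemma fun_span_zero: "(\<lambda>_. 0) \<in> fun_span S"
  using module.span_zero[OF module_fun] by (simp add: fun_span_def zero_fun_def)

lemma fun_span_lincomb:
  "f \<in> fun_span S \<Longrightarrow> g \<in> fun_span S \<Longrightarrow> (\<lambda>x. c * f x + g x) \<in> fun_span S"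
  using module.span_add[OF module_fun module.span_scale[OF module_fun], of f S g c]
  by (simp add: fun_span_def plus_fun_def)

lemma fun_span_induct [consumes 1, case_names zero step]:
  assumes "f \<in> fun_span S" "P (\<lambda>_. 0)"
    and "\<And>c f g. f \<in> S \<Longrightarrow> P g \<Longrightarrow> P (\<lambda>x. c * f x + g x)"
  shows "P f"
proof (rule module.span_induct_alt[OF module_fun, where x = f and S = S and h = P])
  show "f \<in> module.span (\<lambda>c f x. c * f x) S" using assms(1) by (simp add: fun_span_def)
  show "P 0" using assms(2) by (simp add: zero_fun_def)
  show "P ((\<lambda>x. c * f x) + g)" if "f \<in> S" "P g" for c f g
    using assms(3)[OF that, of c] by (simp add: plus_fun_def)
qed

text \<open>The map that sends \<open>u\<close> to \<open>\<lambda>x. q x * u (p x)\<close> is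
  linear, so it suffices to treat generators. Equality is asked only on \<open>X\<close>, because a
  product formula is known only on the disk or bidisk. The maps \<open>p\<close> used below are the
  coordinate projections, the embedding \<open>z \<mapsto> (z, 0)\<close> and the exchange of
  variables.\<close>

lemma fun_span_mult_restrict:
  assumes u: "u \<in> fun_span S"
    and T: "\<And>f. f \<in> S \<Longrightarrow> \<exists>t \<in> fun_span T. \<forall>x \<in> X. t x = q x * f (p x)"
  shows "\<exists>t \<in> fun_span T. \<forall>x \<in> X. t x = q x * u (p x)"
  using u
proof (induction rule: fun_span_induct)
  case zero
  show ?case using fun_span_zero by fastforce
next
  case (step c f g)
  obtain s where s: "s \<in> fun_span T" "\<forall>x \<in> X. s x = q x * f (p x)" using T[OF step(1)] by blast
  obtain t where t: "t \<in> fun_span T" "\<forall>x \<in> X. t x = q x * g (p x)" using step(2) by blast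
  show ?case
    by (rule bexI[OF _ fun_span_lincomb[OF s(1) t(1), of c]]) (simp add: s(2) t(2) algebra_simps)
qed

section \<open>Spans of monomial multiples\<close>

abbreviation disk_shifts :: "(complex \<Rightarrow> complex) \<Rightarrow> (complex \<Rightarrow> complex) set" where
  "disk_shifts g \<equiv> range (\<lambda>k. \<lambda>z. z ^ k * g z)"

abbreviation bidisk_shifts :: "(complex \<times> complex \<Rightarrow> complex) \<Rightarrow> (complex \<times> complex \<Rightarrow> complex) set" where
  "bidisk_shifts f \<equiv> {\<lambda>(z1, z2). z1 ^ k * z2 ^ l * f (z1, z2) | k l. True}"

text \<open>Bilinearity in two rounds: first \<open>u\<close> is reduced to a generator with
  \<open>v\<close> as fixed multiplier, then \<open>v\<close> with that generator fixed. A product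
  of two generators is a monomial multiple of \<open>f\<close> on the bidisk.\<close>

lemma fun_span_shifts_tensor:
  assumes u: "u \<in> fun_span (disk_shifts g)" and v: "v \<in> fun_span (disk_shifts h)"
    and f: "\<And>z1 z2. (z1, z2) \<in> bidisk \<Longrightarrow> f (z1, z2) = g z1 * h z2"
  shows "\<exists>t \<in> fun_span (bidisk_shifts f). \<forall>z \<in> bidisk. t z = v (snd z) * u (fst z)"
proof (rule fun_span_mult_restrict[OF u])
  fix x assume "x \<in> disk_shifts g"
  then obtain k where x: "x = (\<lambda>z. z ^ k * g z)" by blast
  have "\<exists>t \<in> fun_span (bidisk_shifts f). \<forall>z \<in> bidisk. t z = x (fst z) * v (snd z)"
  proof (rule fun_span_mult_restrict[OF v])
    fix y assume "y \<in> disk_shifts h"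
    then obtain l where y: "y = (\<lambda>z. z ^ l * h z)" by blast
    show "\<exists>t \<in> fun_span (bidisk_shifts f). \<forall>z \<in> bidisk. t z = x (fst z) * y (snd z)"
      by (rule bexI[of _ "\<lambda>(z1, z2). z1 ^ k * z2 ^ l * f (z1, z2)"])
        (auto simp: x y f mult_ac intro!: fun_span_base)
  qed
  then show "\<exists>t \<in> fun_span (bidisk_shifts f). \<forall>z \<in> bidisk. t z = v (snd z) * x (fst z)"
    by (simp add: mult.commute)
qed

lemma fun_span_shifts_slice:
  assumes s: "s \<in> fun_span (bidisk_shifts f)"
    and f: "\<And>z1 z2. (z1, z2) \<in> bidisk \<Longrightarrow> f (z1, z2) = g z1 * h z2"
  shows "\<exists>t \<in> fun_span (disk_shifts g). \<forall>z \<in> ball 0 1. t z = s (z, 0)"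
proof -
  have "\<exists>t \<in> fun_span (disk_shifts g). \<forall>z \<in> ball 0 1. t z = 1 * s (z, 0)"
  proof (rule fun_span_mult_restrict[OF s])
    fix x assume "x \<in> bidisk_shifts f"
    then obtain k l where x: "x = (\<lambda>(z1, z2). z1 ^ k * z2 ^ l * f (z1, z2))" by blast
    \<comment> \<open>The slice of a generator is a scalar multiple of \<open>z ^ k * g z\<close>,
      with scalar 0 when \<open>l > 0\<close>. The summand 0 gives the shape of
      \<open>fun_span_lincomb\<close>.\<close>
    have "(\<lambda>z. (0 ^ l * h 0) * (z ^ k * g z) + 0) \<in> fun_span (disk_shifts g)"
      by (intro fun_span_lincomb fun_span_base fun_span_zero) auto
    then show "\<exists>t \<in> fun_span (disk_shifts g). \<forall>z \<in> ball 0 1. t z = 1 * x (z, 0)"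
      by (rule bexI[rotated]) (auto simp: x f bidisk_def)
  qed
  then show ?thesis by simp
qed

lemma fun_span_shifts_swap:
  assumes "s \<in> fun_span (bidisk_shifts f)"
  shows "s \<circ> prod.swap \<in> fun_span (bidisk_shifts (f \<circ> prod.swap))"
proof -
  have "\<exists>t \<in> fun_span (bidisk_shifts (f \<circ> prod.swap)). \<forall>z \<in> UNIV. t z = 1 * s (prod.swap z)"
  proof (rule fun_span_mult_restrict[OF assms])
    fix x assume "x \<in> bidisk_shifts f"
    then obtain k l where x: "x = (\<lambda>(z1, z2). z1 ^ k * z2 ^ l * f (z1, z2))" by blast
    \<comment> \<open>The exchange of variables also exchanges the exponents \<open>k\<close> and
      \<open>l\<close>.\<close>
    show "\<exists>t \<in> fun_span (bidisk_shifts (f \<circ> prod.swap)). \<forall>z \<in> UNIV. t z = 1 * x (prod.swap z)"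
      by (rule bexI[of _ "\<lambda>(z1, z2). z1 ^ l * z2 ^ k * (f \<circ> prod.swap) (z1, z2)"])
        (auto simp: x intro!: fun_span_base)
  qed
  then obtain t where t: "t \<in> fun_span (bidisk_shifts (f \<circ> prod.swap))" "\<And>z. t z = s (prod.swap z)"
    by auto
  then have "s \<circ> prod.swap = t" by auto
  with t(1) show ?thesis by simp
qed

section \<open>Closures and the density of polynomials\<close>

lemma bidisk_closureD:
  assumes "F \<in> bidisk_closure \<alpha> S"
  shows "F \<in> bidisk_space \<alpha>"
    and "e > 0 \<Longrightarrow> \<exists>s \<in> S. s \<in> bidisk_space \<alpha> \<and> bidisk_norm \<alpha> (\<lambda>z. F z - s z) < e"
  using assms by (auto simp: bidisk_closure_def)

lemma bidisk_closure_lincomb: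
  assumes F: "F \<in> bidisk_closure \<alpha> (fun_span S)" and G: "G \<in> bidisk_closure \<alpha> (fun_span S)"
  shows "(\<lambda>z. c * F z + G z) \<in> bidisk_closure \<alpha> (fun_span S)"
  unfolding bidisk_closure_def mem_Collect_eq
proof (intro conjI allI impI)
  show "(\<lambda>z. c * F z + G z) \<in> bidisk_space \<alpha>"
    by (intro bidisk_space_lincomb bidisk_closureD[OF F] bidisk_closureD[OF G])
  fix e :: real assume "e > 0"
  \<comment> \<open>Chosen so that \<open>cmod c * d \<le> e / 2\<close>; adding 1 to the
    denominator covers \<open>c = 0\<close>.\<close>
  define d where "d = e / 2 / (cmod c + 1)"
  have c: "cmod c + 1 > 0" by (simp add: add_nonneg_pos)
  have d: "d > 0" "(cmod c + 1) * d = e / 2"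
    using c \<open>e > 0\<close> by (simp_all add: d_def del: divide_divide_eq_left)
  obtain s where s: "s \<in> fun_span S" "s \<in> bidisk_space \<alpha>"
      "bidisk_norm \<alpha> (\<lambda>z. F z - s z) < d"
    using bidisk_closureD(2)[OF F d(1)] by blast
  obtain t where t: "t \<in> fun_span S" "t \<in> bidisk_space \<alpha>" "bidisk_norm \<alpha> (\<lambda>z. G z - t z) < e / 2"
    using bidisk_closureD(2)[OF G, of "e / 2"] \<open>e > 0\<close> by auto
  have "bidisk_norm \<alpha> (\<lambda>z. c * (F z - s z) + (G z - t z))
      \<le> cmod c * bidisk_norm \<alpha> (\<lambda>z. F z - s z) + bidisk_norm \<alpha> (\<lambda>z. G z - t z)"
    using bidisk_closureD(1)[OF F] bidisk_closureD(1)[OF G] s(2) t(2)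
    by (intro bidisk_space_lincomb bidisk_space_diff)
  \<comment> \<open>Strictness comes from the second summand, since the first may vanish with
    \<open>c\<close>.\<close>
  also have "\<dots> < cmod c * d + e / 2"
    using s(3) t(3) by (intro add_le_less_mono mult_left_mono) auto
  also have "\<dots> \<le> e"
    using d by (simp add: algebra_simps)
  finally have "bidisk_norm \<alpha> (\<lambda>z. c * F z + G z - (c * s z + t z)) < e"
    by (simp add: algebra_simps)
  then show "\<exists>s \<in> fun_span S \<inter> bidisk_space \<alpha>. bidisk_norm \<alpha> (\<lambda>z. c * F z + G z - s z) < e"
    using s t by (intro bexI[of _ "\<lambda>z. c * s z + t z"]) (auto intro: fun_span_lincomb bidisk_space_lincomb)
qed

lemma has_bidisk_series_finite_sum:
  assumes "finite J"
  shows "has_bidisk_series (\<lambda>(z1, z2). \<Sum>(k, l)\<in>J. a k l * (z1 ^ k * z2 ^ l))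
    (\<lambda>k l. if (k, l) \<in> J then a k l else 0)"
  unfolding has_bidisk_series_def
proof clarify
  fix z1 z2 :: complex
  have "((\<lambda>(k, l). a k l * (z1 ^ k * z2 ^ l)) has_sum (\<Sum>(k, l)\<in>J. a k l * (z1 ^ k * z2 ^ l))) J"
    using assms by (intro has_sum_finite)
  then show "((\<lambda>(k, l). (if (k, l) \<in> J then a k l else 0) * z1 ^ k * z2 ^ l)
      has_sum (\<Sum>(k, l)\<in>J. a k l * (z1 ^ k * z2 ^ l))) UNIV"
    by (rule has_sum_cong_neutral[THEN iffD1, rotated -1]) (auto simp: mult_ac)
qed

text \<open>Polynomials are dense: a finite truncation of the double series is close to
  \<open>F\<close>, lies in the closure by linearity, and is in turn close to an element of the
  span.\<close>

lemma bidisk_closure_eqI: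
  assumes mono: "\<And>k l. (\<lambda>(z1, z2). z1 ^ k * z2 ^ l) \<in> bidisk_closure \<alpha> (fun_span S)"
  shows "bidisk_closure \<alpha> (fun_span S) = bidisk_space \<alpha>"
proof
  show "bidisk_closure \<alpha> (fun_span S) \<subseteq> bidisk_space \<alpha>"
    by (auto simp: bidisk_closure_def)
  show "bidisk_space \<alpha> \<subseteq> bidisk_closure \<alpha> (fun_span S)"
  proof
    fix F assume F: "F \<in> bidisk_space \<alpha>"
    then obtain a where a: "has_bidisk_series F a" "(\<lambda>(k, l). a k l) \<in> l2 (bidisk_weight \<alpha>)"
      by (rule bidisk_spaceE)
    show "F \<in> bidisk_closure \<alpha> (fun_span S)"
      unfolding bidisk_closure_def mem_Collect_eq
    proof (intro conjI allI impI F)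
      fix e :: real assume "e > 0"
      then obtain J where J: "finite J" "l2_norm (bidisk_weight \<alpha>) (\<lambda>p. (case p of (k, l) \<Rightarrow> a k l)
          - (if p \<in> J then case p of (k, l) \<Rightarrow> a k l else 0)) < e / 2"
        using l2_truncation[OF bidisk_weight_nonneg a(2), of "e / 2"] by auto
      \<comment> \<open>The index set is a parameter of \<open>P\<close>, to allow induction over
        it.\<close>
      define P where "P J = (\<lambda>(z1, z2). \<Sum>(k, l)\<in>J. a k l * (z1 ^ k * z2 ^ l))" for J
      have "has_bidisk_series (\<lambda>z. (-1) * P J z + F z) (\<lambda>k l. (-1) * (if (k, l) \<in> J then a k l else 0) + a k l)"
        unfolding P_def by (intro has_bidisk_series_lincomb has_bidisk_series_finite_sum J a)
      from bidisk_norm_eq[OF this] J(2) have FP: "bidisk_norm \<alpha> (\<lambda>z. F z - P J z) < e / 2"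
        by (simp add: case_prod_unfold cong: if_cong)
      have "P J \<in> bidisk_closure \<alpha> (fun_span S)"
        using J(1)
      proof (induction J)
        case empty
        \<comment> \<open>The zero polynomial is written as \<open>-1 + 1\<close> to obtain it from
          the closure under linear combinations.\<close>
        have "P {} = (\<lambda>z. (-1) * (\<lambda>(z1, z2). z1 ^ 0 * z2 ^ 0) z + (\<lambda>(z1, z2). z1 ^ 0 * z2 ^ 0) z)"
          by (auto simp: P_def)
        then show ?case by (simp only: bidisk_closure_lincomb[OF mono mono])
      next
        case (insert p J)
        obtain k l where p: "p = (k, l)" by fastforce
        have "P (insert p J) = (\<lambda>z. a k l * (\<lambda>(z1, z2). z1 ^ k * z2 ^ l) z + P J z)"
          using insert by (auto simp: P_def p)
        then show ?case by (simp only: bidisk_closure_lincomb[OF mono insert.IH])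
      qed
      note PJ = bidisk_closureD[OF this]
      obtain s where s: "s \<in> fun_span S" "s \<in> bidisk_space \<alpha>" "bidisk_norm \<alpha> (\<lambda>z. P J z - s z) < e / 2"
        using PJ(2)[of "e / 2"] \<open>e > 0\<close> by auto
      have "bidisk_norm \<alpha> (\<lambda>z. 1 * (F z - P J z) + (P J z - s z))
          \<le> cmod 1 * bidisk_norm \<alpha> (\<lambda>z. F z - P J z) + bidisk_norm \<alpha> (\<lambda>z. P J z - s z)"
        by (intro bidisk_space_lincomb bidisk_space_diff F PJ s)
      with FP s show "\<exists>s \<in> fun_span S \<inter> bidisk_space \<alpha>. bidisk_norm \<alpha> (\<lambda>z. F z - s z) < e"
        by (intro bexI[of _ s]) auto
    qed
  qed
qed


section \<open>Cyclicity of products\<close>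

text \<open>The exchange of variables is an isometric involution that maps the span of the multiples
  of \<open>f\<close> into that of \<open>f \<circ> prod.swap\<close>. It reduces the claim about
  the second factor to the first.\<close>

lemma bidisk_cyclic_swap:
  assumes "bidisk_cyclic \<alpha> f"
  shows "bidisk_cyclic \<alpha> (f \<circ> prod.swap)"
  unfolding bidisk_cyclic_def
proof (intro conjI equalityI subsetI)
  show "f \<circ> prod.swap \<in> bidisk_space \<alpha>"
    using assms by (auto simp: bidisk_cyclic_def intro: bidisk_space_swap)
  fix F assume F: "F \<in> bidisk_space \<alpha>"
  show "F \<in> bidisk_closure \<alpha> (fun_span (bidisk_shifts (f \<circ> prod.swap)))"
    unfolding bidisk_closure_def mem_Collect_eq
  proof (intro conjI allI impI F)
    fix e :: real assume "e > 0"
    have "F \<circ> prod.swap \<in> bidisk_closure \<alpha> (fun_span (bidisk_shifts f))"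
      using bidisk_space_swap(1)[OF F] assms by (simp add: bidisk_cyclic_def)
    from bidisk_closureD(2)[OF this \<open>e > 0\<close>] obtain s where s: "s \<in> fun_span (bidisk_shifts f)"
      "s \<in> bidisk_space \<alpha>" "bidisk_norm \<alpha> (\<lambda>z. (F \<circ> prod.swap) z - s z) < e" by blast
    have "bidisk_norm \<alpha> (\<lambda>z. F z - (s \<circ> prod.swap) z) = bidisk_norm \<alpha> (\<lambda>z. (F \<circ> prod.swap) z - s z)"
      using bidisk_space_swap(2)[OF bidisk_space_diff[OF bidisk_space_swap(1)[OF F] s(2)]]
      by (simp add: o_def)
    with s(3) have "bidisk_norm \<alpha> (\<lambda>z. F z - (s \<circ> prod.swap) z) < e" by simp
    with fun_span_shifts_swap[OF s(1)] bidisk_space_swap(1)[OF s(2)]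
    show "\<exists>t \<in> fun_span (bidisk_shifts (f \<circ> prod.swap)) \<inter> bidisk_space \<alpha>.
        bidisk_norm \<alpha> (\<lambda>z. F z - t z) < e"
      by blast
  qed
qed (auto simp: bidisk_closure_def)

text \<open>The factorization is a condition on an arbitrary \<open>f\<close>, so that
  \<open>f \<circ> prod.swap\<close> with the factors in reverse order is covered too.\<close>

lemma bidisk_cyclic_imp_D_cyclic:
  assumes g: "g \<in> D_space \<alpha>" and cyc: "bidisk_cyclic \<alpha> f"
    and f: "\<And>z1 z2. (z1, z2) \<in> bidisk \<Longrightarrow> f (z1, z2) = g z1 * h z2"
  shows "D_cyclic \<alpha> g"
  unfolding D_cyclic_def
proof (intro conjI equalityI subsetI g)
  fix F assume F: "F \<in> D_space \<alpha>"
  \<comment> \<open>The constant 1 appears as \<open>z2 ^ 0\<close>, so that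
    \<open>monomial_in_D_space\<close> applies to the second factor.\<close>
  define G where "G = (\<lambda>(z1, z2). F z1 * z2 ^ 0 :: complex)"
  have G: "G \<in> bidisk_space \<alpha>"
    unfolding G_def by (intro bidisk_space_tensor F monomial_in_D_space)
  show "F \<in> D_closure \<alpha> (fun_span (disk_shifts g))"
    unfolding D_closure_def mem_Collect_eq
  proof (intro conjI allI impI F)
    fix e :: real assume "e > 0"
    have "G \<in> bidisk_closure \<alpha> (fun_span (bidisk_shifts f))"
      using G cyc by (simp add: bidisk_cyclic_def)
    from bidisk_closureD(2)[OF this \<open>e > 0\<close>] obtain s where s: "s \<in> fun_span (bidisk_shifts f)"
      "s \<in> bidisk_space \<alpha>" "bidisk_norm \<alpha> (\<lambda>z. G z - s z) < e" by blast
    obtain t where t: "t \<in> fun_span (disk_shifts g)" "\<And>z. z \<in> ball 0 1 \<Longrightarrow> t z = s (z, 0)"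
      using fun_span_shifts_slice[OF s(1) f] by blast
    have "t \<in> D_space \<alpha>"
      by (rule D_space_cong(1)[OF bidisk_space_slice(1)[OF s(2)]]) (simp add: t)
    moreover have "D_norm \<alpha> (\<lambda>z. G (z, 0) - s (z, 0)) = D_norm \<alpha> (\<lambda>z. F z - t z)"
      by (rule D_space_cong(2)[OF bidisk_space_slice(1)[OF bidisk_space_diff[OF G s(2)]]])
        (simp add: t G_def)
    ultimately show "\<exists>t \<in> fun_span (disk_shifts g) \<inter> D_space \<alpha>. D_norm \<alpha> (\<lambda>z. F z - t z) < e"
      using t(1) s(3) bidisk_space_slice(2)[OF bidisk_space_diff[OF G s(2)]]
      by (intro bexI[of _ t]) auto
  qed
qed (auto simp: D_closure_def)

lemma D_cyclicD:
  assumes "D_cyclic \<alpha> g" "F \<in> D_space \<alpha>" "e > 0"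
  shows "\<exists>u \<in> fun_span (disk_shifts g). u \<in> D_space \<alpha> \<and> D_norm \<alpha> (\<lambda>z. F z - u z) < e"
  using assms by (auto simp: D_cyclic_def D_closure_def)

lemma D_cyclic_imp_bidisk_cyclic:
  assumes g: "D_cyclic \<alpha> g" and h: "D_cyclic \<alpha> h"
    and f: "\<And>z1 z2. (z1, z2) \<in> bidisk \<Longrightarrow> f (z1, z2) = g z1 * h z2"
  shows "bidisk_cyclic \<alpha> f"
  unfolding bidisk_cyclic_def
proof
  show "f \<in> bidisk_space \<alpha>"
    by (rule bidisk_space_cong(1)[OF bidisk_space_tensor(1)[of g _ h]])
      (use g h f in \<open>auto simp: D_cyclic_def\<close>)
  show "bidisk_closure \<alpha> (fun_span (bidisk_shifts f)) = bidisk_space \<alpha>"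
  proof (rule bidisk_closure_eqI)
    fix k l :: nat
    let ?x = "\<lambda>z::complex. z ^ k" and ?y = "\<lambda>z::complex. z ^ l"
    let ?F = "\<lambda>(z1, z2). ?x z1 * ?y z2"
    note x = monomial_in_D_space[of k \<alpha>] and y = monomial_in_D_space[of l \<alpha>]
    have F: "?F \<in> bidisk_space \<alpha>" by (intro bidisk_space_tensor x y)
    show "?F \<in> bidisk_closure \<alpha> (fun_span (bidisk_shifts f))"
      unfolding bidisk_closure_def mem_Collect_eq
    proof (intro conjI allI impI F)
      \<comment> \<open>The choice \<open>e / (M + 1)\<close> also works for
        \<open>M = 0\<close>.\<close>
      have small: "\<exists>d > 0. M * d < e" if "e > 0" "M \<ge> 0" for e M :: real
        using that by (intro exI[of _ "e / (M + 1)"]) (auto simp: field_simps add_nonneg_pos)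
      fix e :: real assume "e > 0"
      \<comment> \<open>The order matters: \<open>v\<close> is chosen first, with a tolerance
        depending on the norm of \<open>z ^ k\<close>; the tolerance for \<open>u\<close> then
        depends on the norm of \<open>v\<close>.\<close>
      then obtain d where d: "d > 0" "D_norm \<alpha> ?x * d < e / 2"
        using small[of "e / 2" "D_norm \<alpha> ?x"] D_norm_nonneg[OF x] by auto
      obtain v where v: "v \<in> fun_span (disk_shifts h)" "v \<in> D_space \<alpha>" "D_norm \<alpha> (\<lambda>z. ?y z - v z) < d"
        using D_cyclicD[OF h y d(1)] by blast
      obtain d' where d': "d' > 0" "D_norm \<alpha> v * d' < e / 2"
        using small[of "e / 2" "D_norm \<alpha> v"] D_norm_nonneg[OF v(2)] \<open>e > 0\<close> by auto
      obtain u where u: "u \<in> fun_span (disk_shifts g)" "u \<in> D_space \<alpha>" "D_norm \<alpha> (\<lambda>z. ?x z - u z) < d'"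
        using D_cyclicD[OF g x d'(1)] by blast
      obtain t where t: "t \<in> fun_span (bidisk_shifts f)" "\<And>z. z \<in> bidisk \<Longrightarrow> t z = v (snd z) * u (fst z)"
        using fun_span_shifts_tensor[OF u(1) v(1) f] by blast
      have "t \<in> bidisk_space \<alpha>"
        by (rule bidisk_space_cong(1)[OF bidisk_space_tensor(1)[OF u(2) v(2)]]) (auto simp: t)
      \<comment> \<open>\<open>x \<otimes> y - u \<otimes> v = x \<otimes> (y - v) + (x - u) \<otimes> v\<close>\<close>
      let ?A = "\<lambda>(z1, z2). ?x z1 * (?y z2 - v z2)" and ?B = "\<lambda>(z1, z2). (?x z1 - u z1) * v z2"
      note A = bidisk_space_tensor[OF x D_space_diff[OF y v(2)]]
        and B = bidisk_space_tensor[OF D_space_diff[OF x u(2)] v(2)]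
      have "bidisk_norm \<alpha> (\<lambda>z. ?F z - t z) = bidisk_norm \<alpha> (\<lambda>z. 1 * ?A z + ?B z)"
        by (rule bidisk_space_cong(2)[OF bidisk_space_diff[OF F \<open>t \<in> bidisk_space \<alpha>\<close>]])
          (auto simp: t algebra_simps)
      also have "\<dots> \<le> cmod 1 * bidisk_norm \<alpha> ?A + bidisk_norm \<alpha> ?B"
        by (rule bidisk_space_lincomb(2)[OF A(1) B(1)])
      also have "\<dots> = D_norm \<alpha> ?x * D_norm \<alpha> (\<lambda>z. ?y z - v z) + D_norm \<alpha> v * D_norm \<alpha> (\<lambda>z. ?x z - u z)"
        unfolding A(2) B(2) by simp
      also have "\<dots> \<le> D_norm \<alpha> ?x * d + D_norm \<alpha> v * d'"
        using u v x D_norm_nonneg by (intro add_mono mult_left_mono) (auto intro: less_imp_le)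
      also have "\<dots> < e" using d d' by simp
      finally show "\<exists>s \<in> fun_span (bidisk_shifts f) \<inter> bidisk_space \<alpha>. bidisk_norm \<alpha> (\<lambda>z. ?F z - s z) < e"
        using t(1) \<open>t \<in> bidisk_space \<alpha>\<close> by blast
    qed
  qed
qed

theorem proposition2p4:
  fixes \<alpha> :: real and g h :: "complex \<Rightarrow> complex" and f :: "complex \<times> complex \<Rightarrow> complex"
  assumes "g \<in> D_space \<alpha>" and "h \<in> D_space \<alpha>"
    and "\<And>z1 z2. (z1, z2) \<in> bidisk \<Longrightarrow> f (z1, z2) = g z1 * h z2"
  shows "bidisk_cyclic \<alpha> f \<longleftrightarrow> D_cyclic \<alpha> g \<and> D_cyclic \<alpha> h"
proof (intro iffI conjI)
  assume f: "bidisk_cyclic \<alpha> f"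
  show "D_cyclic \<alpha> g" by (rule bidisk_cyclic_imp_D_cyclic[OF assms(1) f assms(3)])
  show "D_cyclic \<alpha> h"
    \<comment> \<open>After the exchange \<open>h\<close> is the factor in the first variable and
      \<open>g\<close> the one in the second.\<close>
    by (rule bidisk_cyclic_imp_D_cyclic[OF assms(2) bidisk_cyclic_swap[OF f], of g])
      (auto simp: assms(3) bidisk_def mult.commute)
next
  assume "D_cyclic \<alpha> g \<and> D_cyclic \<alpha> h"
  then show "bidisk_cyclic \<alpha> f" using D_cyclic_imp_bidisk_cyclic assms(3) by blast
qed

end
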